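(* Let $\kappa$ be a measurable cardinal, let $\tau=(2^\kappa)^+$, and for every $\alpha<\tau$ let $\theta_\alpha<\kappa$ be a cardinal. The following are equivalent: (α) $\kappa$ carries at least $\tau$-many (distinct) normal ultrafilters. (β) There are $\tau$-many distinct $\kappa$-complete ultrafilters $(U_\alpha:\alpha<\tau)$ on $\kappa$ such that for every $\alpha<\tau$ there is a function $f_\alpha:\kappa\to\kappa$ with $[f_\alpha]_{U_\alpha}=\kappa$ which is $\theta_\alpha^+$-bounded, i.e. $|f_\alpha^{-1}(\{\beta\})|<\theta_\alpha^+$ for every $\beta<\kappa$.
   Context: All filters and ultrafilters are non-principal. An ultrafilter $U$ on $\kappa$ is $\kappa$-complete if it is closed under intersections of fewer than $\kappa$ of its members, and normal if it is closed under diagonal intersections of length $\kappa$. For a $\kappa$-complete ultrafilter $U$ on $\kappa$ and $f:\kappa\to\kappa$, $[f]_U$ denotes the ordinal represented by the equivalence class of $f$ in the (transitive collapse of the) ultrapower $\mathbf V^\kappa/U$. $\theta^+$ denotes the cardinal successor of $\theta$.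
   Formalization: The cardinals θ_α are required to be nonzero: if some θ_α = 0, then θ_α^+ = 1 forces all fibres of f_α to be empty, so (β) is false even when (α) holds. *)

theory Defs
  imports Main "HOL-Library.FuncSet"
begin

unbundle cardinal_syntax

text \<open>
  A cardinal \<open>\<kappa>\<close> is a cardinal order \<open>r\<close> (\<^term>\<open>Card_order r\<close>, which is a reflexive well-order);
  the ordinals below \<open>\<kappa>\<close> are the elements of \<^term>\<open>Field r\<close>, and \<open>\<alpha> < \<xi>\<close> is
  \<^term>\<open>\<alpha> \<in> underS r \<xi>\<close>. A filter on \<open>S\<close> is a set of subsets of \<open>S\<close>.
\<close>

definition ultrafilter_on :: "'a set \<Rightarrow> 'a set set \<Rightarrow> bool" where
  "ultrafilter_on S U \<longleftrightarrow>
     U \<subseteq> Pow S \<and> S \<in> U \<and> {} \<notin> U \<and>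
     (\<forall>X\<in>U. \<forall>Y\<in>U. X \<inter> Y \<in> U) \<and>
     (\<forall>X\<in>U. \<forall>Y. X \<subseteq> Y \<and> Y \<subseteq> S \<longrightarrow> Y \<in> U) \<and>
     (\<forall>X. X \<subseteq> S \<longrightarrow> X \<in> U \<or> S - X \<in> U)"

definition nonprincipal_ultrafilter_on :: "'a set \<Rightarrow> 'a set set \<Rightarrow> bool" where
  "nonprincipal_ultrafilter_on S U \<longleftrightarrow>
     ultrafilter_on S U \<and> \<not> (\<exists>a\<in>S. U = {X. X \<subseteq> S \<and> a \<in> X})"

definition complete_ultrafilter :: "'a rel \<Rightarrow> 'a set set \<Rightarrow> bool" where
  "complete_ultrafilter r U \<longleftrightarrow>
     nonprincipal_ultrafilter_on (Field r) U \<and>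
     (\<forall>\<A>. \<A> \<subseteq> U \<and> \<A> \<noteq> {} \<and> |\<A>| <o r \<longrightarrow> \<Inter>\<A> \<in> U)"

definition diagonal_Inter :: "'a rel \<Rightarrow> ('a \<Rightarrow> 'a set) \<Rightarrow> 'a set" where
  "diagonal_Inter r X = {\<xi> \<in> Field r. \<forall>\<alpha> \<in> underS r \<xi>. \<xi> \<in> X \<alpha>}"

definition normal_ultrafilter :: "'a rel \<Rightarrow> 'a set set \<Rightarrow> bool" where
  "normal_ultrafilter r U \<longleftrightarrow>
     nonprincipal_ultrafilter_on (Field r) U \<and>
     (\<forall>X. (\<forall>\<alpha> \<in> Field r. X \<alpha> \<in> U) \<longrightarrow> diagonal_Inter r X \<in> U)"

definition measurable_cardinal :: "'a rel \<Rightarrow> bool" where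
  "measurable_cardinal r \<longleftrightarrow>
     Card_order r \<and> natLeq <o r \<and> (\<exists>U. complete_ultrafilter r U)"

definition ultrapower_eq :: "'a rel \<Rightarrow> 'a set set \<Rightarrow> ('a \<Rightarrow> 'a) rel" where
  "ultrapower_eq r U =
     {(f, g). f \<in> Field r \<rightarrow> Field r \<and> g \<in> Field r \<rightarrow> Field r \<and>
              {x \<in> Field r. f x = g x} \<in> U}"

definition ultrapower_class :: "'a rel \<Rightarrow> 'a set set \<Rightarrow> ('a \<Rightarrow> 'a) \<Rightarrow> ('a \<Rightarrow> 'a) set" where
  "ultrapower_class r U f = ultrapower_eq r U `` {f}"

definition ultrapower_ord :: "'a rel \<Rightarrow> 'a set set \<Rightarrow> ('a \<Rightarrow> 'a) set rel" where
  "ultrapower_ord r U =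
     {(ultrapower_class r U f, ultrapower_class r U g) | f g.
        f \<in> Field r \<rightarrow> Field r \<and> g \<in> Field r \<rightarrow> Field r \<and>
        {x \<in> Field r. (f x, g x) \<in> r} \<in> U}"

text \<open>
  The ordinal \<open>[f]\<^sub>U\<close>, up to order isomorphism. The transitive collapse \<open>\<pi>\<close> of \<open>V\<^sup>\<kappa>/U\<close> satisfies
  \<open>\<pi>[f] = {\<pi>[g] | g. [g] \<in>\<^sub>U [f]}\<close>, so for ordinal-valued \<open>f\<close> the ordinal \<open>\<pi>[f]\<close> is the order
  type of the predecessors of the class of \<open>f\<close>. If \<open>f\<close> maps \<open>\<kappa>\<close> to \<open>\<kappa>\<close>, every predecessor in
  \<open>V\<^sup>\<kappa>/U\<close> is represented by a function from \<open>\<kappa>\<close> to \<open>\<kappa>\<close>, so no other functions are needed.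
\<close>

definition ultrapower_ordinal ::
    "'a rel \<Rightarrow> 'a set set \<Rightarrow> ('a \<Rightarrow> 'a) \<Rightarrow> ('a \<Rightarrow> 'a) set rel" where
  "ultrapower_ordinal r U f =
     Restr (ultrapower_ord r U) (underS (ultrapower_ord r U) (ultrapower_class r U f))"

definition fibre_bounded :: "'a rel \<Rightarrow> 'b rel \<Rightarrow> ('a \<Rightarrow> 'a) \<Rightarrow> bool" where
  "fibre_bounded r \<mu> f \<longleftrightarrow> (\<forall>\<beta> \<in> Field r. |{x \<in> Field r. f x = \<beta>}| <o \<mu>)"

end

theory Submission
  imports Defs
begin

text \<open>
  A \<open>\<kappa>\<close>-complete \<open>U\<close> and \<open>f\<close> with \<open>[f]\<^sub>U = \<kappa>\<close> yield the normal ultrafilter \<open>V = f\<^sub>*U\<close>. If the fibres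
  of \<open>f\<close> have size at most \<open>\<theta> < \<kappa>\<close>, then \<open>\<kappa>\<close> splits into \<open>\<theta>\<close> sets on each of which \<open>f\<close> is injective,
  and one of them, \<open>A\<close>, lies in \<open>U\<close>. Hence \<open>U\<close> is recovered from \<open>V\<close> and the graph of \<open>f\<close> on \<open>A\<close>.
  There are only \<open>2\<^sup>\<kappa>\<close> such graphs, so \<open>(2\<^sup>\<kappa>)\<^sup>+\<close> many \<open>U\<close> need \<open>(2\<^sup>\<kappa>)\<^sup>+\<close> many \<open>V\<close>. Conversely,
  \<open>[id]\<^sub>U = \<kappa>\<close> for every normal \<open>\<kappa>\<close>-complete \<open>U\<close>.

  Closure under diagonal intersections alone does not make \<open>U\<close> \<open>\<kappa>\<close>-complete: a normal ultrafilter on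
  a measurable \<open>\<gamma> < \<kappa>\<close> induces one on \<open>\<kappa>\<close> that is closed under diagonal intersections. As \<open>\<kappa>\<close> is a
  strong limit, there are at most \<open>\<kappa>\<close> such exceptions.
\<close>

section \<open>Ultrafilters as the quantifier "for almost every x"\<close>

lemma ultrafilter_onD:
  assumes "ultrafilter_on S U"
  shows "\<And>X. X \<in> U \<Longrightarrow> X \<subseteq> S" and "S \<in> U" and "{} \<notin> U"
    and "\<And>X Y. X \<in> U \<Longrightarrow> Y \<in> U \<Longrightarrow> X \<inter> Y \<in> U"
    and "\<And>X Y. X \<in> U \<Longrightarrow> X \<subseteq> Y \<Longrightarrow> Y \<subseteq> S \<Longrightarrow> Y \<in> U"
    and "\<And>X. X \<subseteq> S \<Longrightarrow> X \<notin> U \<Longrightarrow> S - X \<in> U"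
  using assms unfolding ultrafilter_on_def by blast+

lemma ultrafilter_on_Collect_mono:
  assumes "ultrafilter_on S U" "{x \<in> S. P x} \<in> U" "\<And>x. x \<in> S \<Longrightarrow> P x \<Longrightarrow> Q x"
  shows "{x \<in> S. Q x} \<in> U"
  by (rule ultrafilter_onD(5)[OF assms(1,2)]) (use assms(3) in auto)

lemma ultrafilter_on_Collect_mono2:
  assumes "ultrafilter_on S U" "{x \<in> S. P x} \<in> U" "{x \<in> S. P' x} \<in> U"
    and "\<And>x. x \<in> S \<Longrightarrow> P x \<Longrightarrow> P' x \<Longrightarrow> Q x"
  shows "{x \<in> S. Q x} \<in> U"
  by (rule ultrafilter_onD(5)[OF assms(1) ultrafilter_onD(4)[OF assms(1-3)]]) (use assms(4) in auto)

lemma ultrafilter_on_Collect_not: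
  assumes "ultrafilter_on S U"
  shows "{x \<in> S. \<not> P x} \<in> U \<longleftrightarrow> {x \<in> S. P x} \<notin> U"
proof
  assume n: "{x \<in> S. \<not> P x} \<in> U"
  show "{x \<in> S. P x} \<notin> U"
  proof
    assume "{x \<in> S. P x} \<in> U"
    from ultrafilter_onD(4)[OF assms n this] have "{x \<in> S. \<not> P x} \<inter> {x \<in> S. P x} \<in> U" .
    moreover have "{x \<in> S. \<not> P x} \<inter> {x \<in> S. P x} = {}" by auto
    ultimately show False using ultrafilter_onD(3)[OF assms] by simp
  qed
next
  assume "{x \<in> S. P x} \<notin> U"
  then have "S - {x \<in> S. P x} \<in> U" by (intro ultrafilter_onD(6)[OF assms]) auto
  moreover have "S - {x \<in> S. P x} = {x \<in> S. \<not> P x}" by auto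
  ultimately show "{x \<in> S. \<not> P x} \<in> U" by simp
qed

lemma ultrafilter_on_Collect_ex:
  assumes "ultrafilter_on S U" "{x \<in> S. P x} \<in> U"
  obtains x where "x \<in> S" "P x"
  using ultrafilter_onD(3)[OF assms(1)] assms(2)
  by (metis (no_types, lifting) Collect_empty_eq)

text \<open>A member missing \<open>a\<close> would meet \<open>{a}\<close> in the empty set, so an
  ultrafilter with member \<open>{a}\<close> is the principal one at \<open>a\<close>.\<close>

lemma nonprincipal_ultrafilter_on_singleton:
  assumes "nonprincipal_ultrafilter_on S U"
  shows "{a} \<notin> U"
proof
  assume a: "{a} \<in> U"
  have u: "ultrafilter_on S U" using assms nonprincipal_ultrafilter_on_def by blast
  have "a \<in> S" using ultrafilter_onD(1)[OF u a] by simp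
  moreover have "U = {X. X \<subseteq> S \<and> a \<in> X}"
  proof (intro set_eqI iffI)
    fix X assume X: "X \<in> U"
    have "a \<in> X"
    proof (rule ccontr)
      assume "a \<notin> X"
      then have "X \<inter> {a} = {}" by simp
      then show False using ultrafilter_onD(3,4)[OF u] X a by metis
    qed
    then show "X \<in> {X. X \<subseteq> S \<and> a \<in> X}" using ultrafilter_onD(1)[OF u X] by simp
  next
    fix X assume "X \<in> {X. X \<subseteq> S \<and> a \<in> X}"
    then show "X \<in> U" using ultrafilter_onD(5)[OF u a] by simp
  qed
  ultimately show False using assms unfolding nonprincipal_ultrafilter_on_def by metis
qed

section \<open>Consequences of \<kappa>-completeness\<close>

lemma complete_ultrafilterD:
  assumes "complete_ultrafilter r U"
  shows "nonprincipal_ultrafilter_on (Field r) U" "ultrafilter_on (Field r) U"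
  using assms unfolding complete_ultrafilter_def nonprincipal_ultrafilter_on_def by auto

lemma complete_ultrafilter_Inter:
  assumes "complete_ultrafilter r U" "|I| <o r" "\<And>i. i \<in> I \<Longrightarrow> {x \<in> Field r. P i x} \<in> U"
  shows "{x \<in> Field r. \<forall>i\<in>I. P i x} \<in> U"
proof (cases "I = {}")
  \<comment> \<open>Completeness speaks of nonempty families only, since \<open>\<Inter>{}\<close>
    is the whole type rather than \<open>Field r\<close>.\<close>
  case True
  then show ?thesis using ultrafilter_onD(2)[OF complete_ultrafilterD(2)[OF assms(1)]] by simp
next
  case False
  let ?A = "(\<lambda>i. {x \<in> Field r. P i x}) ` I"
  have "|?A| <o r" using card_of_image assms(2) ordLeq_ordLess_trans by blast
  moreover have "?A \<subseteq> U" "?A \<noteq> {}" using assms(3) False by auto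
  ultimately have "\<Inter>?A \<in> U"
    using assms(1) unfolding complete_ultrafilter_def by metis
  moreover have "\<Inter>?A = {x \<in> Field r. \<forall>i\<in>I. P i x}" using False by auto
  ultimately show ?thesis by simp
qed

text \<open>If every value in \<open>I\<close> were avoided almost everywhere, then by completeness
  all of them at once would be, although \<open>h\<close> lies in \<open>I\<close> almost
  everywhere.\<close>

lemma complete_ultrafilter_constant:
  assumes "complete_ultrafilter r U" "|I| <o r" "{x \<in> Field r. h x \<in> I} \<in> U"
  obtains i where "i \<in> I" "{x \<in> Field r. h x = i} \<in> U"
proof -
  note u = complete_ultrafilterD(2)[OF assms(1)]
  have "\<exists>i\<in>I. {x \<in> Field r. h x = i} \<in> U"
  proof (rule ccontr)
    assume "\<not> ?thesis"
    then have "{x \<in> Field r. h x \<noteq> i} \<in> U" if "i \<in> I" for i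
      using that by (simp add: ultrafilter_on_Collect_not[OF u])
    from complete_ultrafilter_Inter[OF assms(1,2) this]
    have "{x \<in> Field r. \<forall>i\<in>I. h x \<noteq> i} \<in> U" .
    then have "{x \<in> Field r. h x \<notin> I} \<in> U"
      by (rule ultrafilter_on_Collect_mono[OF u]) auto
    then show False using assms(3) by (simp add: ultrafilter_on_Collect_not[OF u])
  qed
  then show thesis using that by blast
qed

text \<open>Otherwise \<kappa> injects into \<open>Pow B\<close> by some \<open>h\<close>. For each
  \<open>b\<close>, \<open>U\<close> decides whether \<open>b \<in> h x\<close> almost everywhere;
  let \<open>T\<close> collect the positive decisions. By completeness \<open>h x\<close> equals
  \<open>T\<close> for almost every \<open>x\<close>, but injectivity allows only one such
  \<open>x\<close>, so \<open>U\<close> would contain a singleton.\<close>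

lemma complete_ultrafilter_strong_limit:
  assumes "complete_ultrafilter r U" "Card_order r" "|B| <o r"
  shows "|Pow B| <o r"
proof (rule ccontr)
  note u = complete_ultrafilterD(2)[OF assms(1)]
  assume "\<not> |Pow B| <o r"
  then have "r \<le>o |Pow B|"
    using assms(2) card_of_Well_order card_order_on_well_order_on not_ordLess_iff_ordLeq by blast
  then have "|Field r| \<le>o |Pow B|"
    using assms(2) card_of_Field_ordIso ordIso_ordLeq_trans by blast
  then obtain h where h: "inj_on h (Field r)" "h ` Field r \<subseteq> Pow B"
    using card_of_ordLeq[of "Field r" "Pow B"] by blast
  define T where "T = {b \<in> B. {x \<in> Field r. b \<in> h x} \<in> U}"
  have "{x \<in> Field r. b \<in> h x \<longleftrightarrow> b \<in> T} \<in> U" if "b \<in> B" for b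
    using that ultrafilter_on_Collect_not[OF u, of "\<lambda>x. b \<in> h x"] by (cases "b \<in> T") (auto simp: T_def)
  from complete_ultrafilter_Inter[OF assms(1,3) this]
  have *: "{x \<in> Field r. \<forall>b\<in>B. b \<in> h x \<longleftrightarrow> b \<in> T} \<in> U" .
  then obtain a where a: "a \<in> Field r" "\<forall>b\<in>B. b \<in> h a \<longleftrightarrow> b \<in> T"
    by (rule ultrafilter_on_Collect_ex[OF u])
  have "x = a" if "x \<in> Field r" "\<forall>b\<in>B. b \<in> h x \<longleftrightarrow> b \<in> T" for x
  proof -
    have "h x = h a" using that a h(2) by blast
    then show ?thesis using h(1) that a by (auto dest: inj_onD)
  qed
  then have "{x \<in> Field r. \<forall>b\<in>B. b \<in> h x \<longleftrightarrow> b \<in> T} = {a}" using a by blast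
  then show False
    using * nonprincipal_ultrafilter_on_singleton[OF complete_ultrafilterD(1)[OF assms(1)]] by metis
qed

section \<open>The order of the ultrapower\<close>

lemma ultrapower_class_eq_iff:
  assumes u: "ultrafilter_on (Field r) U"
    and fg: "f \<in> Field r \<rightarrow> Field r" "g \<in> Field r \<rightarrow> Field r"
  shows "ultrapower_class r U f = ultrapower_class r U g \<longleftrightarrow> {x \<in> Field r. f x = g x} \<in> U"
proof -
  have "equiv (Field r \<rightarrow> Field r) (ultrapower_eq r U)"
  proof (rule equivI)
    show "ultrapower_eq r U \<subseteq> (Field r \<rightarrow> Field r) \<times> (Field r \<rightarrow> Field r)"
      by (auto simp: ultrapower_eq_def)
    show "refl_on (Field r \<rightarrow> Field r) (ultrapower_eq r U)"
      using ultrafilter_onD(2)[OF u] by (auto simp: refl_on_def ultrapower_eq_def)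
    show "sym (ultrapower_eq r U)"
      by (auto simp: sym_def ultrapower_eq_def elim!: ultrafilter_on_Collect_mono[OF u])
    show "trans (ultrapower_eq r U)"
      by (auto simp: trans_def ultrapower_eq_def intro: ultrafilter_on_Collect_mono2[OF u])
  qed
  then have "ultrapower_class r U f = ultrapower_class r U g \<longleftrightarrow> (f, g) \<in> ultrapower_eq r U"
    unfolding ultrapower_class_def using fg by (rule eq_equiv_class_iff)
  then show ?thesis using fg by (simp add: ultrapower_eq_def)
qed

text \<open>The theorem of Los for \<open>r\<close>: the representatives picked in
  \<open>ultrapower_ord\<close> agree with \<open>f\<close> and \<open>g\<close> almost everywhere,
  so their choice does not matter.\<close>

lemma ultrapower_ord_iff:
  assumes u: "ultrafilter_on (Field r) U"
    and fg: "f \<in> Field r \<rightarrow> Field r" "g \<in> Field r \<rightarrow> Field r"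
  shows "(ultrapower_class r U f, ultrapower_class r U g) \<in> ultrapower_ord r U
    \<longleftrightarrow> {x \<in> Field r. (f x, g x) \<in> r} \<in> U"
proof
  assume "(ultrapower_class r U f, ultrapower_class r U g) \<in> ultrapower_ord r U"
  then obtain f' g' where 1: "f' \<in> Field r \<rightarrow> Field r" "g' \<in> Field r \<rightarrow> Field r"
      "ultrapower_class r U f = ultrapower_class r U f'"
      "ultrapower_class r U g = ultrapower_class r U g'"
    and 2: "{x \<in> Field r. (f' x, g' x) \<in> r} \<in> U"
    unfolding ultrapower_ord_def by blast
  have "{x \<in> Field r. f x = f' x} \<in> U" "{x \<in> Field r. g x = g' x} \<in> U"
    using 1 fg ultrapower_class_eq_iff[OF u] by blast+
  then have "{x \<in> Field r. f x = f' x \<and> g x = g' x} \<in> U"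
    by (rule ultrafilter_on_Collect_mono2[OF u]) auto
  then show "{x \<in> Field r. (f x, g x) \<in> r} \<in> U"
    by (rule ultrafilter_on_Collect_mono2[OF u 2]) auto
next
  assume "{x \<in> Field r. (f x, g x) \<in> r} \<in> U"
  then show "(ultrapower_class r U f, ultrapower_class r U g) \<in> ultrapower_ord r U"
    unfolding ultrapower_ord_def using fg by blast
qed

lemma ultrapower_ord_underS_iff:
  assumes u: "ultrafilter_on (Field r) U"
    and fg: "f \<in> Field r \<rightarrow> Field r" "g \<in> Field r \<rightarrow> Field r"
  shows "ultrapower_class r U g \<in> underS (ultrapower_ord r U) (ultrapower_class r U f)
    \<longleftrightarrow> {x \<in> Field r. g x \<in> underS r (f x)} \<in> U"
proof -
  have "{x \<in> Field r. g x \<in> underS r (f x)} \<in> U \<longleftrightarrow>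
    {x \<in> Field r. g x \<noteq> f x} \<in> U \<and> {x \<in> Field r. (g x, f x) \<in> r} \<in> U"
    unfolding underS_def
    by (auto elim: ultrafilter_on_Collect_mono[OF u] ultrafilter_on_Collect_mono2[OF u])
  then show ?thesis
    using ultrapower_class_eq_iff[OF u fg(2,1)] ultrapower_ord_iff[OF u fg(2,1)]
      ultrafilter_on_Collect_not[OF u, of "\<lambda>x. g x = f x"]
    by (auto simp: underS_def)
qed

lemma ultrapower_ord_underSE:
  assumes "c \<in> underS (ultrapower_ord r U) d"
  obtains g where "g \<in> Field r \<rightarrow> Field r" "c = ultrapower_class r U g"
  using assms unfolding underS_def ultrapower_ord_def by blast

section \<open>Constant classes and the meaning of [f]_U = \<kappa>\<close>

abbreviation constant_class :: "'a rel \<Rightarrow> 'a set set \<Rightarrow> 'a \<Rightarrow> ('a \<Rightarrow> 'a) set" where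
  "constant_class r U c \<equiv> ultrapower_class r U (\<lambda>_. c)"

lemma constant_class_ord_iff:
  assumes u: "ultrafilter_on (Field r) U" and "c \<in> Field r" "d \<in> Field r"
  shows "(constant_class r U c, constant_class r U d) \<in> ultrapower_ord r U \<longleftrightarrow> (c, d) \<in> r"
proof -
  have "{x \<in> Field r. (c, d) \<in> r} = (if (c, d) \<in> r then Field r else {})" by auto
  then show ?thesis
    using ultrapower_ord_iff[OF u, of "\<lambda>_. c" "\<lambda>_. d"] assms ultrafilter_onD(2,3)[OF u] by auto
qed

lemma inj_on_constant_class:
  assumes u: "ultrafilter_on (Field r) U"
  shows "inj_on (constant_class r U) (Field r)"
proof (rule inj_onI)
  fix c d assume cd: "c \<in> Field r" "d \<in> Field r" "constant_class r U c = constant_class r U d"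
  then have "{x \<in> Field r. c = d} \<in> U"
    using ultrapower_class_eq_iff[OF u, of "\<lambda>_. c" "\<lambda>_. d"] by auto
  then show "c = d" by (rule ultrafilter_on_Collect_ex[OF u])
qed

text \<open>\<open>above\<close> puts every constant class below the class of \<open>f\<close>, and
  \<open>press\<close> makes every class below it constant. So the predecessors are a copy of
  \<open>r\<close>.\<close>

lemma ultrapower_ordinal_eq_dir_image:
  assumes u: "ultrafilter_on (Field r) U" and f: "f \<in> Field r \<rightarrow> Field r"
    and above: "\<And>c. c \<in> Field r \<Longrightarrow> {x \<in> Field r. c \<in> underS r (f x)} \<in> U"
    and press: "\<And>g. g \<in> Field r \<rightarrow> Field r \<Longrightarrow> {x \<in> Field r. g x \<in> underS r (f x)} \<in> U \<Longrightarrow>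
      \<exists>c\<in>Field r. {x \<in> Field r. g x = c} \<in> U"
  shows "ultrapower_ordinal r U f = dir_image r (constant_class r U)"
proof -
  let ?h = "constant_class r U"
  have under: "underS (ultrapower_ord r U) (ultrapower_class r U f) = ?h ` Field r"
  proof (intro set_eqI iffI)
    fix c assume c: "c \<in> underS (ultrapower_ord r U) (ultrapower_class r U f)"
    then obtain g where g: "g \<in> Field r \<rightarrow> Field r" "c = ultrapower_class r U g"
      by (rule ultrapower_ord_underSE)
    then obtain d where d: "d \<in> Field r" "{x \<in> Field r. g x = d} \<in> U"
      using c press ultrapower_ord_underS_iff[OF u f] by blast
    then have "c = ?h d" using ultrapower_class_eq_iff[OF u g(1), of "\<lambda>_. d"] g by auto
    then show "c \<in> ?h ` Field r" using d by simp
  next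
    fix c assume "c \<in> ?h ` Field r"
    then obtain d where d: "d \<in> Field r" "c = ?h d" by blast
    then show "c \<in> underS (ultrapower_ord r U) (ultrapower_class r U f)"
      using above[OF d(1)] ultrapower_ord_underS_iff[OF u f, of "\<lambda>_. d"] by auto
  qed
  show ?thesis unfolding ultrapower_ordinal_def under dir_image_def
    using constant_class_ord_iff[OF u] by (fastforce intro: FieldI1 FieldI2)
qed

text \<open>Converse to the previous lemma. The isomorphism alone does not tell which classes lie
  below that of \<open>f\<close>. If \<open>f\<close> were bounded almost everywhere, there would be
  fewer than \<kappa> of them. Hence all constant classes are among them; they form an initial
  segment of type \<kappa> in an order of type \<kappa>, hence all of it.\<close>

lemma ultrapower_ordinal_ordIsoD:
  assumes U: "complete_ultrafilter r U" and r: "Card_order r"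
    and f: "f \<in> Field r \<rightarrow> Field r" and iso: "ultrapower_ordinal r U f =o r"
  shows "c \<in> Field r \<Longrightarrow> {x \<in> Field r. c \<in> underS r (f x)} \<in> U"
    and "g \<in> Field r \<rightarrow> Field r \<Longrightarrow> {x \<in> Field r. g x \<in> underS r (f x)} \<in> U \<Longrightarrow>
      \<exists>c\<in>Field r. {x \<in> Field r. g x = c} \<in> U"
proof -
  let ?h = "constant_class r U" and ?W = "ultrapower_ord r U"
  let ?P = "ultrapower_ordinal r U f"
  note u = complete_ultrafilterD(2)[OF U]
  have wo: "Well_order r" using r card_order_on_well_order_on by blast
  have trans: "trans r" and antisym: "antisym r" and refl: "\<And>x. x \<in> Field r \<Longrightarrow> (x, x) \<in> r"
    using wo unfolding order_on_defs refl_on_def by auto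
  have lin: "(x, y) \<in> r \<or> y \<in> underS r x" if "x \<in> Field r" "y \<in> Field r" for x y
    using wo that refl[OF that(1)] unfolding order_on_defs total_on_def underS_def by auto
  \<comment> \<open>A function below the constant \<open>c\<close> takes fewer than \<kappa> values
    almost everywhere, so completeness makes it constant.\<close>
  have below_constant: "\<exists>d \<in> underS r c. {x \<in> Field r. g x = d} \<in> U"
    if "c \<in> Field r" "{x \<in> Field r. g x \<in> underS r c} \<in> U" for c and g :: "'a \<Rightarrow> 'a"
    using complete_ultrafilter_constant[OF U card_of_underS[OF r that(1)] that(2)] by metis
  \<comment> \<open>A restriction may have a smaller field than the set it is restricted to;
    reflexivity of the ultrapower order rules this out.\<close>
  have FieldP: "Field ?P = underS ?W (ultrapower_class r U f)"
  proof -
    have "(c, c) \<in> ?W" if c: "c \<in> underS ?W (ultrapower_class r U f)" for c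
    proof -
      obtain g where g: "g \<in> Field r \<rightarrow> Field r" "c = ultrapower_class r U g"
        by (rule ultrapower_ord_underSE[OF c])
      have "{x \<in> Field r. (g x, g x) \<in> r} \<in> U"
        by (rule ultrafilter_on_Collect_mono[OF u, of "\<lambda>_. True"])
          (use g refl ultrafilter_onD(2)[OF u] in auto)
      then show ?thesis using g ultrapower_ord_iff[OF u] by blast
    qed
    then show ?thesis unfolding ultrapower_ordinal_def Field_def by blast
  qed
  show above: "{x \<in> Field r. c \<in> underS r (f x)} \<in> U" if c: "c \<in> Field r" for c
  proof (rule ccontr)
    assume "{x \<in> Field r. c \<in> underS r (f x)} \<notin> U"
    then have "{x \<in> Field r. c \<notin> underS r (f x)} \<in> U"
      by (simp add: ultrafilter_on_Collect_not[OF u])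
    then have le: "{x \<in> Field r. (f x, c) \<in> r} \<in> U"
      by (rule ultrafilter_on_Collect_mono[OF u]) (use lin f c in blast)
    \<comment> \<open>With \<open>f\<close> at most \<open>c\<close> almost everywhere, every class
      below that of \<open>f\<close> is the class of a constant below \<open>c\<close>. These are
      too few for an order of type \<kappa>.\<close>
    have "Field ?P \<subseteq> ?h ` underS r c"
    proof
      fix p assume p: "p \<in> Field ?P"
      then obtain g where g: "g \<in> Field r \<rightarrow> Field r" "p = ultrapower_class r U g"
        unfolding FieldP by (rule ultrapower_ord_underSE)
      then have "{x \<in> Field r. g x \<in> underS r (f x)} \<in> U"
        using p FieldP ultrapower_ord_underS_iff[OF u f] by blast
      then have "{x \<in> Field r. g x \<in> underS r c} \<in> U"
        using le by (rule ultrafilter_on_Collect_mono2[OF u])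
          (use transD[OF trans] antisymD[OF antisym] in \<open>auto simp: underS_def\<close>)
      then obtain d where d: "d \<in> underS r c" "{x \<in> Field r. g x = d} \<in> U"
        using below_constant[OF c] by blast
      then have "d \<in> Field r" by (auto simp: underS_def intro: FieldI1)
      then have "p = ?h d" using ultrapower_class_eq_iff[OF u g(1), of "\<lambda>_. d"] g d by auto
      then show "p \<in> ?h ` underS r c" using d by simp
    qed
    then have "|Field ?P| <o r"
      using card_of_underS[OF r c] card_of_image card_of_mono1 ordLeq_ordLess_trans by metis
    moreover have "r =o |Field ?P|"
      using card_of_cong[OF iso] card_of_Field_ordIso[OF r] ordIso_symmetric ordIso_transitive by metis
    ultimately show False using not_ordLess_ordIso ordIso_symmetric by blast
  qed
  obtain k where woP: "Well_order ?P" and k: "embed ?P r k"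
    using iso unfolding ordIso_def iso_def by blast
  have h_in: "?h c \<in> Field ?P" if "c \<in> Field r" for c
    using above[OF that] ultrapower_ord_underS_iff[OF u f, of "\<lambda>_. c"] that FieldP by auto
  have P_iff: "(?h c, ?h d) \<in> ?P \<longleftrightarrow> (c, d) \<in> r" if "c \<in> Field r" "d \<in> Field r" for c d
    using h_in that constant_class_ord_iff[OF u that] FieldP by (auto simp: ultrapower_ordinal_def)
  \<comment> \<open>A class below a constant one is itself constant by
    \<open>below_constant\<close>, so the constant classes form an initial segment of
    \<open>?P\<close>.\<close>
  have "embed r ?P ?h"
    unfolding embed_def bij_betw_def
  proof (intro ballI conjI)
    fix c assume c: "c \<in> Field r"
    show "inj_on ?h (under r c)"
      using inj_on_constant_class[OF u] by (rule inj_on_subset) (auto simp: under_def intro: FieldI1)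
    show "?h ` under r c = under ?P (?h c)"
    proof (intro equalityI subsetI)
      fix p assume "p \<in> ?h ` under r c"
      then show "p \<in> under ?P (?h c)" using P_iff c by (auto simp: under_def intro: FieldI1)
    next
      fix p assume p: "p \<in> under ?P (?h c)"
      show "p \<in> ?h ` under r c"
      proof (cases "p = ?h c")
        case True
        then show ?thesis using refl[OF c] by (auto simp: under_def)
      next
        case False
        then have p': "p \<in> underS ?W (?h c)"
          using p by (auto simp: under_def underS_def ultrapower_ordinal_def)
        then obtain g where g: "g \<in> Field r \<rightarrow> Field r" "p = ultrapower_class r U g"
          by (rule ultrapower_ord_underSE)
        have "{x \<in> Field r. g x \<in> underS r c} \<in> U"
          using p' g ultrapower_ord_underS_iff[OF u, of "\<lambda>_. c"] c by auto
        then obtain d where d: "d \<in> underS r c" "{x \<in> Field r. g x = d} \<in> U"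
          using below_constant[OF c] by blast
        then have "d \<in> Field r" by (auto simp: underS_def intro: FieldI1)
        then have "p = ?h d" using ultrapower_class_eq_iff[OF u g(1), of "\<lambda>_. d"] g d by auto
        then show ?thesis using d by (auto simp: under_def underS_def)
      qed
    qed
  qed
  \<comment> \<open>\<open>?h\<close> and \<open>k\<close> embed the two well-orders into each
    other, which makes \<open>?h\<close> onto.\<close>
  then have bij: "?h ` Field r = Field ?P"
    using embed_bothWays_bij_betw[OF wo woP _ k] by (auto simp: bij_betw_def)
  show "\<exists>c\<in>Field r. {x \<in> Field r. g x = c} \<in> U"
    if g: "g \<in> Field r \<rightarrow> Field r" "{x \<in> Field r. g x \<in> underS r (f x)} \<in> U"
  proof -
    have "ultrapower_class r U g \<in> ?h ` Field r"
      unfolding bij FieldP using g ultrapower_ord_underS_iff[OF u f] by blast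
    then obtain c where "c \<in> Field r" "ultrapower_class r U g = ?h c" by blast
    then show ?thesis using ultrapower_class_eq_iff[OF u g(1), of "\<lambda>_. c"] by auto
  qed
qed

section \<open>The push-forward of U along f and its normality\<close>

definition image_ultrafilter :: "'a rel \<Rightarrow> ('a \<Rightarrow> 'a) \<Rightarrow> 'a set set \<Rightarrow> 'a set set" where
  "image_ultrafilter r f U = {X. X \<subseteq> Field r \<and> {x \<in> Field r. f x \<in> X} \<in> U}"

lemma ultrafilter_on_image_ultrafilter:
  assumes u: "ultrafilter_on (Field r) U" and f: "f \<in> Field r \<rightarrow> Field r"
  shows "ultrafilter_on (Field r) (image_ultrafilter r f U)"
proof -
  let ?V = "image_ultrafilter r f U"
  have 1: "{x \<in> Field r. f x \<in> Field r} = Field r" using f by auto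
  have 2: "{x \<in> Field r. f x \<in> Field r - X} = {x \<in> Field r. f x \<notin> X}" for X using f by auto
  show ?thesis
    unfolding ultrafilter_on_def
  proof (intro conjI ballI allI impI)
    show "?V \<subseteq> Pow (Field r)" by (auto simp: image_ultrafilter_def)
    show "Field r \<in> ?V" using ultrafilter_onD(2)[OF u] by (simp add: image_ultrafilter_def 1)
    show "{} \<notin> ?V" using ultrafilter_onD(3)[OF u] by (simp add: image_ultrafilter_def)
  next
    fix X Y assume "X \<in> ?V" "Y \<in> ?V"
    then have XY: "X \<subseteq> Field r" "{x \<in> Field r. f x \<in> X} \<in> U" "{x \<in> Field r. f x \<in> Y} \<in> U"
      by (auto simp: image_ultrafilter_def)
    have "{x \<in> Field r. f x \<in> X \<inter> Y} \<in> U"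
      by (rule ultrafilter_on_Collect_mono2[OF u XY(2,3)]) simp
    then show "X \<inter> Y \<in> ?V" using XY by (auto simp: image_ultrafilter_def)
  next
    fix X Y assume "X \<in> ?V" and XY: "X \<subseteq> Y \<and> Y \<subseteq> Field r"
    then have "{x \<in> Field r. f x \<in> X} \<in> U" by (auto simp: image_ultrafilter_def)
    then have "{x \<in> Field r. f x \<in> Y} \<in> U"
      by (rule ultrafilter_on_Collect_mono[OF u]) (use XY in auto)
    then show "Y \<in> ?V" using XY by (auto simp: image_ultrafilter_def)
  next
    fix X assume "X \<subseteq> Field r"
    then show "X \<in> ?V \<or> Field r - X \<in> ?V"
      unfolding image_ultrafilter_def mem_Collect_eq 2 ultrafilter_on_Collect_not[OF u] by blast
  qed
qed

text \<open>\<open>f\<close> exceeds each \<open>a\<close> almost everywhere, so the image is not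
  principal. If a diagonal intersection failed to be large, then almost everywhere some index below
  \<open>f x\<close> would witness \<open>f x \<notin> X \<alpha>\<close>. As [f]_U = \<kappa>, this
  index is a constant \<open>c\<close> almost everywhere, which contradicts that \<open>X c\<close>
  is large.\<close>

lemma normal_image_ultrafilter:
  assumes U: "complete_ultrafilter r U" and r: "Card_order r"
    and f: "f \<in> Field r \<rightarrow> Field r" and iso: "ultrapower_ordinal r U f =o r"
  shows "normal_ultrafilter r (image_ultrafilter r f U)"
proof -
  let ?V = "image_ultrafilter r f U"
  note u = complete_ultrafilterD(2)[OF U]
  note D = ultrapower_ordinal_ordIsoD[OF U r f iso]
  have "?V \<noteq> {X. X \<subseteq> Field r \<and> a \<in> X}" if a: "a \<in> Field r" for a
  proof
    assume "?V = {X. X \<subseteq> Field r \<and> a \<in> X}"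
    then have "{a} \<in> ?V" using a by simp
    then have "{x \<in> Field r. f x = a} \<in> U" by (simp add: image_ultrafilter_def)
    then have "{x \<in> Field r. False} \<in> U"
      using D(1)[OF a] by (rule ultrafilter_on_Collect_mono2[OF u]) (auto simp: underS_def)
    then show False by (rule ultrafilter_on_Collect_ex[OF u])
  qed
  moreover have "diagonal_Inter r X \<in> ?V" if X: "\<forall>\<alpha>\<in>Field r. X \<alpha> \<in> ?V" for X
  proof (rule ccontr)
    assume "diagonal_Inter r X \<notin> ?V"
    then have "{x \<in> Field r. f x \<in> diagonal_Inter r X} \<notin> U"
      by (auto simp: image_ultrafilter_def diagonal_Inter_def)
    then have *: "{x \<in> Field r. f x \<notin> diagonal_Inter r X} \<in> U"
      by (simp add: ultrafilter_on_Collect_not[OF u])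
    \<comment> \<open>\<open>g\<close> chooses the failing index; the value \<open>x\<close>
      elsewhere only keeps \<open>g\<close> inside \<open>Field r\<close>.\<close>
    define g where "g x = (if f x \<in> diagonal_Inter r X then x
      else SOME \<alpha>. \<alpha> \<in> underS r (f x) \<and> f x \<notin> X \<alpha>)" for x
    have g: "g x \<in> underS r (f x) \<and> f x \<notin> X (g x)"
      if "x \<in> Field r" "f x \<notin> diagonal_Inter r X" for x
    proof -
      have "\<exists>\<alpha>. \<alpha> \<in> underS r (f x) \<and> f x \<notin> X \<alpha>"
        using that f by (auto simp: diagonal_Inter_def)
      from someI_ex[OF this] show ?thesis using that by (simp add: g_def)
    qed
    have gF: "g \<in> Field r \<rightarrow> Field r"
    proof
      fix x assume x: "x \<in> Field r"
      show "g x \<in> Field r"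
      proof (cases "f x \<in> diagonal_Inter r X")
        case True
        then show ?thesis using x by (simp add: g_def)
      next
        case False
        then show ?thesis using g[OF x] by (auto simp: underS_def intro: FieldI1)
      qed
    qed
    have "{x \<in> Field r. g x \<in> underS r (f x)} \<in> U"
      using * by (rule ultrafilter_on_Collect_mono[OF u]) (use g in blast)
    then obtain c where c: "c \<in> Field r" "{x \<in> Field r. g x = c} \<in> U" using D(2)[OF gF] by blast
    have 1: "{x \<in> Field r. f x \<notin> X c} \<in> U"
      using * c(2) by (rule ultrafilter_on_Collect_mono2[OF u]) (use g in blast)
    have "{x \<in> Field r. f x \<in> X c} \<in> U" using X c by (auto simp: image_ultrafilter_def)
    then show False using 1 by (simp add: ultrafilter_on_Collect_not[OF u])
  qed
  ultimately show ?thesis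
    using ultrafilter_on_image_ultrafilter[OF u f]
    unfolding normal_ultrafilter_def nonprincipal_ultrafilter_on_def by blast
qed

section \<open>Recovering U from its push-forward\<close>

lemma fibre_bounded_inj_on_large_set:
  assumes U: "complete_ultrafilter r U" and f: "f \<in> Field r \<rightarrow> Field r"
    and t: "Card_order t" "t <o r" and bd: "fibre_bounded r (cardSuc t) f"
  obtains A where "A \<in> U" "inj_on f A"
proof -
  note u = complete_ultrafilterD(2)[OF U]
  \<comment> \<open>A size below \<open>cardSuc t\<close> is a size at most \<open>t\<close>, so the
    points of each fibre can be labelled injectively by elements of \<open>Field t\<close>.\<close>
  have "\<exists>e. inj_on e {x \<in> Field r. f x = b} \<and> e ` {x \<in> Field r. f x = b} \<subseteq> Field t"
    if "b \<in> Field r" for b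
  proof -
    have "|{x \<in> Field r. f x = b}| \<le>o t"
      using bd that t(1) cardSuc_ordLeq_ordLess[OF t(1) card_of_Card_order]
      unfolding fibre_bounded_def by blast
    then have "|{x \<in> Field r. f x = b}| \<le>o |Field t|"
      using card_of_Field_ordIso[OF t(1)] ordIso_symmetric ordLeq_ordIso_trans by blast
    then show ?thesis using card_of_ordLeq[of "{x \<in> Field r. f x = b}" "Field t"] by blast
  qed
  then have "\<forall>b\<in>Field r. \<exists>e. inj_on e {x \<in> Field r. f x = b} \<and>
      e ` {x \<in> Field r. f x = b} \<subseteq> Field t" by blast
  from bchoice[OF this] obtain e where
    e: "\<And>b. b \<in> Field r \<Longrightarrow> inj_on (e b) {x \<in> Field r. f x = b}"
      "\<And>b. b \<in> Field r \<Longrightarrow> e b ` {x \<in> Field r. f x = b} \<subseteq> Field t"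
    by blast
  have "|Field t| <o r" using t card_of_Field_ordIso ordIso_ordLess_trans by blast
  \<comment> \<open>\<open>e (f x) x\<close> is the label of \<open>x\<close> in its own fibre.
    There are fewer than \<kappa> labels, so one label \<open>i\<close> occurs on a set in
    \<open>U\<close>, and that set meets each fibre at most once.\<close>
  moreover have "{x \<in> Field r. e (f x) x \<in> Field t} \<in> U"
    by (rule ultrafilter_on_Collect_mono[OF u, of "\<lambda>_. True"])
      (use ultrafilter_onD(2)[OF u] e(2) f in \<open>auto simp: Pi_iff\<close>)
  ultimately obtain i where "{x \<in> Field r. e (f x) x = i} \<in> U"
    by (rule complete_ultrafilter_constant[OF U])
  moreover have "inj_on f {x \<in> Field r. e (f x) x = i}"
  proof (rule inj_onI)
    fix x y assume *: "x \<in> {x \<in> Field r. e (f x) x = i}" "y \<in> {x \<in> Field r. e (f x) x = i}" "f x = f y"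
    then have "f x \<in> Field r" using f by auto
    from inj_onD[OF e(1)[OF this], of x y] show "x = y" using * by auto
  qed
  ultimately show thesis by (rule that)
qed

lemma ultrafilter_from_image:
  assumes u: "ultrafilter_on (Field r) U" and f: "f \<in> Field r \<rightarrow> Field r"
    and A: "A \<in> U" "inj_on f A"
  shows "U = {X. X \<subseteq> Field r \<and> {(x, f x) | x. x \<in> A} `` X \<in> image_ultrafilter r f U}"
proof -
  have "X \<in> U \<longleftrightarrow> f ` (X \<inter> A) \<in> image_ultrafilter r f U" if X: "X \<subseteq> Field r" for X
  proof
    assume "X \<in> U"
    then have "X \<inter> A \<in> U" using A ultrafilter_onD(4)[OF u] by blast
    then have "{x \<in> Field r. f x \<in> f ` (X \<inter> A)} \<in> U"
      by (rule ultrafilter_onD(5)[OF u]) (use X in auto)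
    then show "f ` (X \<inter> A) \<in> image_ultrafilter r f U"
      using f X by (auto simp: image_ultrafilter_def)
  next
    assume "f ` (X \<inter> A) \<in> image_ultrafilter r f U"
    then have "{x \<in> Field r. f x \<in> f ` (X \<inter> A)} \<inter> A \<in> U"
      using A ultrafilter_onD(4)[OF u] by (auto simp: image_ultrafilter_def)
    then show "X \<in> U"
      by (rule ultrafilter_onD(5)[OF u]) (use X A(2) in \<open>auto dest: inj_onD\<close>)
  qed
  then have "U = {X. X \<subseteq> Field r \<and> f ` (X \<inter> A) \<in> image_ultrafilter r f U}"
    using ultrafilter_onD(1)[OF u] by blast
  moreover have "{(x, f x) | x. x \<in> A} `` X = f ` (X \<inter> A)" for X by auto
  ultimately show ?thesis by (simp only:)
qed

section \<open>Normal ultrafilters: pressing down, completeness, [id]_U = \<kappa>\<close>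

lemma normal_ultrafilter_press_down:
  assumes "normal_ultrafilter r U" and "{x \<in> Field r. g x \<in> underS r x} \<in> U"
  shows "\<exists>c\<in>Field r. {x \<in> Field r. g x = c} \<in> U"
proof (rule ccontr)
  assume *: "\<not> ?thesis"
  have u: "ultrafilter_on (Field r) U"
    using assms(1) unfolding normal_ultrafilter_def nonprincipal_ultrafilter_on_def by blast
  have "\<forall>c\<in>Field r. {x \<in> Field r. g x \<noteq> c} \<in> U"
    using * by (simp add: ultrafilter_on_Collect_not[OF u])
  \<comment> \<open>Fodor's argument: at a point of this diagonal intersection \<open>g\<close>
    takes no value below that point, so \<open>g\<close> is not regressive there.\<close>
  then have "diagonal_Inter r (\<lambda>c. {x \<in> Field r. g x \<noteq> c}) \<in> U"
    using assms(1) unfolding normal_ultrafilter_def by simp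
  then have "{x \<in> Field r. \<forall>\<alpha>\<in>underS r x. x \<in> Field r \<and> g x \<noteq> \<alpha>} \<in> U"
    by (simp add: diagonal_Inter_def)
  then have "{x \<in> Field r. False} \<in> U"
    using assms(2) by (rule ultrafilter_on_Collect_mono2[OF u]) auto
  then show False by (rule ultrafilter_on_Collect_ex[OF u])
qed

text \<open>Fewer than \<kappa> members can be indexed by some \<open>underS r c\<close>. Beyond
  that segment the diagonal intersection lies in all of them, and \<open>unif\<close> ensures that
  the points beyond it form a set in \<open>U\<close>.\<close>

lemma normal_ultrafilter_complete:
  assumes n: "normal_ultrafilter r U" and r: "Card_order r"
    and unif: "\<And>c. c \<in> Field r \<Longrightarrow> underS r c \<notin> U"
  shows "complete_ultrafilter r U"
  unfolding complete_ultrafilter_def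
proof (intro conjI allI impI)
  show np: "nonprincipal_ultrafilter_on (Field r) U" using n normal_ultrafilter_def by blast
  then have u: "ultrafilter_on (Field r) U" using nonprincipal_ultrafilter_on_def by blast
  fix \<A> assume A: "\<A> \<subseteq> U \<and> \<A> \<noteq> {} \<and> |\<A>| <o r"
  have wo: "Well_order r" using r card_order_on_well_order_on by blast
  obtain c where c: "c \<in> Field r" "|\<A>| =o Restr r (underS r c)"
    using A ordLess_iff_ordIso_Restr[OF wo card_of_Well_order] by blast
  have "Field (Restr r (underS r c)) \<subseteq> underS r c" by (auto simp: Field_def)
  then have "|\<A>| \<le>o |underS r c|"
    using card_of_cong[OF c(2)] card_of_mono1 ordIso_ordLeq_trans by (metis Field_card_of)
  then obtain e where e: "e ` underS r c = \<A>"
    using A card_of_ordLeq2[of \<A> "underS r c"] by auto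
  \<comment> \<open>Indices outside \<open>underS r c\<close> get the trivial set
    \<open>Field r\<close>, as a diagonal intersection needs all indices.\<close>
  define X where "X \<alpha> = (if \<alpha> \<in> underS r c then e \<alpha> else Field r)" for \<alpha>
  have "\<forall>\<alpha>\<in>Field r. X \<alpha> \<in> U" using e A ultrafilter_onD(2)[OF u] by (auto simp: X_def)
  then have 1: "diagonal_Inter r X \<in> U" using n unfolding normal_ultrafilter_def by blast
  have 2: "Field r - underS r c \<in> U"
    by (rule ultrafilter_onD(6)[OF u _ unif[OF c(1)]]) (auto simp: underS_def intro: FieldI1)
  have ge: "\<alpha> \<in> underS r x" if "x \<in> Field r" "x \<notin> underS r c" "\<alpha> \<in> underS r c" for x \<alpha>
  proof -
    have "(c, x) \<in> r"
      using wo that(1,2) c(1) unfolding order_on_defs total_on_def refl_on_def underS_def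
      by (cases "x = c") auto
    moreover have "(\<alpha>, c) \<in> r" "\<alpha> \<noteq> c" using that(3) by (auto simp: underS_def)
    moreover have "trans r" "antisym r" using wo unfolding order_on_defs by auto
    ultimately show ?thesis unfolding underS_def by (auto dest: transD antisymD)
  qed
  have "x \<in> Y" if x: "x \<in> diagonal_Inter r X" "x \<in> Field r - underS r c" and Y: "Y \<in> \<A>" for x Y
  proof -
    obtain \<alpha> where \<alpha>: "\<alpha> \<in> underS r c" "Y = e \<alpha>" using Y e by blast
    then have "\<alpha> \<in> underS r x" using x(2) ge by blast
    then have "x \<in> X \<alpha>" using x(1) unfolding diagonal_Inter_def by blast
    then show ?thesis using \<alpha> by (simp add: X_def)
  qed
  then have "diagonal_Inter r X \<inter> (Field r - underS r c) \<subseteq> \<Inter>\<A>" by blast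
  moreover have "\<Inter>\<A> \<subseteq> Field r" using A ultrafilter_onD(1)[OF u] by blast
  ultimately show "\<Inter>\<A> \<in> U" using ultrafilter_onD(5)[OF u ultrafilter_onD(4)[OF u 1 2]] by blast
qed

text \<open>Otherwise almost every point is at most \<open>c\<close>, hence below \<open>c\<close>
  as \<open>{c}\<close> is not large. That leaves fewer than \<kappa> points, so one of them would
  be a singleton member of \<open>U\<close>.\<close>

lemma complete_ultrafilter_final_segment:
  assumes U: "complete_ultrafilter r U" and r: "Card_order r" and c: "c \<in> Field r"
  shows "{x \<in> Field r. c \<in> underS r x} \<in> U"
proof (rule ccontr)
  note u = complete_ultrafilterD(2)[OF U]
  have wo: "Well_order r" using r card_order_on_well_order_on by blast
  have no_point: "{x \<in> Field r. x = a} \<notin> U" for a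
  proof
    assume *: "{x \<in> Field r. x = a} \<in> U"
    then obtain x where "x \<in> Field r" "x = a" by (rule ultrafilter_on_Collect_ex[OF u])
    then have "{x \<in> Field r. x = a} = {a}" by auto
    then show False
      using * nonprincipal_ultrafilter_on_singleton[OF complete_ultrafilterD(1)[OF U]] by metis
  qed
  assume "{x \<in> Field r. c \<in> underS r x} \<notin> U"
  then have "{x \<in> Field r. c \<notin> underS r x} \<in> U"
    by (simp add: ultrafilter_on_Collect_not[OF u])
  moreover have "{x \<in> Field r. x \<noteq> c} \<in> U"
    using no_point by (simp add: ultrafilter_on_Collect_not[OF u])
  ultimately have "{x \<in> Field r. x \<in> underS r c} \<in> U"
    by (rule ultrafilter_on_Collect_mono2[OF u])
      (use wo c in \<open>auto simp: order_on_defs total_on_def underS_def\<close>)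
  then obtain a where "{x \<in> Field r. x = a} \<in> U"
    by (rule complete_ultrafilter_constant[OF U card_of_underS[OF r c]])
  then show False using no_point by blast
qed

text \<open>For the identity, \<open>above\<close> says that final segments are large and
  \<open>press\<close> is pressing down.\<close>

lemma normal_ultrapower_ordinal_id:
  assumes n: "normal_ultrafilter r U" and U: "complete_ultrafilter r U" and r: "Card_order r"
  shows "ultrapower_ordinal r U (\<lambda>x. x) =o r"
proof -
  note u = complete_ultrafilterD(2)[OF U]
  have "ultrapower_ordinal r U (\<lambda>x. x) = dir_image r (constant_class r U)"
  proof (rule ultrapower_ordinal_eq_dir_image[OF u, where f = "\<lambda>x. x"])
    show "(\<lambda>x. x) \<in> Field r \<rightarrow> Field r" by (rule funcsetI)
    show "{x \<in> Field r. c \<in> underS r x} \<in> U" if "c \<in> Field r" for c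
      using that by (rule complete_ultrafilter_final_segment[OF U r])
    show "\<exists>c\<in>Field r. {x \<in> Field r. g x = c} \<in> U"
      if "{x \<in> Field r. g x \<in> underS r x} \<in> U" for g
      using that by (rule normal_ultrafilter_press_down[OF n])
  qed
  moreover have "Well_order r" using r card_order_on_well_order_on by blast
  ultimately show ?thesis
    using ordIso_symmetric[OF dir_image_ordIso[OF _ inj_on_constant_class[OF u]]] by simp
qed

section \<open>Counting the ultrafilters that contain a proper initial segment\<close>

lemma card_of_bounded_ultrafilters:
  assumes W: "complete_ultrafilter r W" and r: "Card_order r" and inf: "infinite (Field r)"
  shows "|{U. ultrafilter_on (Field r) U \<and> (\<exists>c\<in>Field r. underS r c \<in> U)}| \<le>o r"
proof -
  let ?N = "{U. ultrafilter_on (Field r) U \<and> (\<exists>c\<in>Field r. underS r c \<in> U)}"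
  \<comment> \<open>Such a \<open>U\<close> is determined by \<open>c\<close> and its trace on
    \<open>underS r c\<close>; \<open>?G\<close> rebuilds it from this pair.\<close>
  let ?G = "\<lambda>(c, D). {X. X \<subseteq> Field r \<and> X \<inter> underS r c \<in> D}"
  have "?N \<subseteq> ?G ` (SIGMA c:Field r. Pow (Pow (underS r c)))"
  proof
    fix U assume "U \<in> ?N"
    then obtain c where u: "ultrafilter_on (Field r) U" and c: "c \<in> Field r" "underS r c \<in> U" by blast
    have "X \<in> U" if "X \<subseteq> Field r" "X \<inter> underS r c \<in> U" for X
      by (rule ultrafilter_onD(5)[OF u that(2) _ that(1)]) auto
    moreover have "X \<inter> underS r c \<in> U" if "X \<in> U" for X
      using ultrafilter_onD(4)[OF u that c(2)] .
    ultimately have "U = ?G (c, U \<inter> Pow (underS r c))"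
      using ultrafilter_onD(1)[OF u] by auto
    then show "U \<in> ?G ` (SIGMA c:Field r. Pow (Pow (underS r c)))" using c by blast
  qed
  then have "|?N| \<le>o |SIGMA c:Field r. Pow (Pow (underS r c))|"
    by (rule surj_imp_ordLeq)
  moreover have "|SIGMA c:Field r. Pow (Pow (underS r c))| \<le>o r"
  proof (rule card_of_Sigma_ordLeq_infinite_Field[OF inf r])
    show "|Field r| \<le>o r" using card_of_Field_ordIso[OF r] ordIso_imp_ordLeq by blast
    show "\<forall>c\<in>Field r. |Pow (Pow (underS r c))| \<le>o r"
    proof
      fix c assume "c \<in> Field r"
      then have "|underS r c| <o r" by (rule card_of_underS[OF r])
      \<comment> \<open>The strong limit property coming from \<open>W\<close> is applied once for
        each power set.\<close>
      then have "|Pow (Pow (underS r c))| <o r" by (intro complete_ultrafilter_strong_limit[OF W r])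
      then show "|Pow (Pow (underS r c))| \<le>o r" by (rule ordLess_imp_ordLeq)
    qed
  qed
  ultimately show ?thesis using ordLeq_transitive by blast
qed

section \<open>The equivalence, by counting against 2^\<kappa>\<close>

theorem theorem2p5:
  fixes \<kappa> :: "'a rel"
    and \<tau> :: "('a \<Rightarrow> bool) set rel"
    and \<theta> :: "('a \<Rightarrow> bool) set \<Rightarrow> 'a rel"
  assumes "measurable_cardinal \<kappa>"
    and "\<tau> = cardSuc (ctwo ^c \<kappa>)"
    and "\<And>\<alpha>. \<alpha> \<in> Field \<tau> \<Longrightarrow> Card_order (\<theta> \<alpha>) \<and> \<theta> \<alpha> \<noteq> {} \<and> \<theta> \<alpha> <o \<kappa>"
  shows "\<tau> \<le>o |{U. normal_ultrafilter \<kappa> U}| \<longleftrightarrow>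
    (\<exists>U. inj_on U (Field \<tau>) \<and>
      (\<forall>\<alpha> \<in> Field \<tau>. complete_ultrafilter \<kappa> (U \<alpha>) \<and>
        (\<exists>f \<in> Field \<kappa> \<rightarrow> Field \<kappa>.
           ultrapower_ordinal \<kappa> (U \<alpha>) f =o \<kappa> \<and>
           fibre_bounded \<kappa> (cardSuc (\<theta> \<alpha>)) f)))"
proof -
  let ?N = "{U. normal_ultrafilter \<kappa> U}" and ?C = "ctwo ^c \<kappa>"
  have r: "Card_order \<kappa>" and less: "natLeq <o \<kappa>" and "\<exists>W. complete_ultrafilter \<kappa> W"
    using assms(1) unfolding measurable_cardinal_def by auto
  then obtain W where W: "complete_ultrafilter \<kappa> W" by blast
  have inf: "infinite (Field \<kappa>)"
    using less r natLeq_Cinfinite cinfinite_mono ordLess_imp_ordLeq unfolding cinfinite_def by blast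
  have cC: "Card_order ?C" by (rule Card_order_cexp)
  have pow: "|Pow (Field \<kappa>)| =o ?C"
    using card_of_Pow_Func unfolding cexp_def ctwo_def by (simp add: Field_card_of)
  have kC: "\<kappa> <o ?C" using Card_order_Pow[OF r] pow ordLess_ordIso_trans by blast
  have infC: "infinite (Field ?C)"
    using kC inf cinfinite_mono ordLess_imp_ordLeq unfolding cinfinite_def by blast
  have Ct: "?C <o \<tau>" using assms(2) cardSuc_greater[OF cC] by simp
  have ct: "Card_order \<tau>" using assms(2) cardSuc_Card_order[OF cC] by simp
  have wt: "Well_order \<tau>" using ct card_order_on_well_order_on by blast
  have inft: "infinite (Field \<tau>)"
    using Ct infC cinfinite_mono ordLess_imp_ordLeq unfolding cinfinite_def by blast
  show ?thesis
  proof
    assume le: "\<tau> \<le>o |?N|"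
    \<comment> \<open>\<open>?B\<close> contains every normal ultrafilter that might fail to be
      complete. It has at most \<kappa> < \<tau> elements, so \<tau> normal ultrafilters remain
      outside it.\<close>
    let ?B = "{U. ultrafilter_on (Field \<kappa>) U \<and> (\<exists>c\<in>Field \<kappa>. underS \<kappa> c \<in> U)}"
    have "|?B| <o \<tau>"
      using card_of_bounded_ultrafilters[OF W r inf] kC Ct ordLeq_ordLess_trans ordLess_transitive by blast
    moreover have "?N \<subseteq> (?N - ?B) \<union> ?B" by blast
    then have "\<tau> \<le>o |(?N - ?B) \<union> ?B|" using le card_of_mono1 ordLeq_transitive by blast
    ultimately have "\<not> |?N - ?B| <o \<tau>"
      using card_of_Un_ordLess_infinite_Field[OF inft ct] not_ordLess_ordLeq by blast
    then have "\<tau> \<le>o |?N - ?B|" using not_ordLess_iff_ordLeq[OF wt card_of_Well_order] by blast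
    then have "|Field \<tau>| \<le>o |?N - ?B|"
      using card_of_Field_ordIso[OF ct] ordIso_ordLeq_trans by blast
    then obtain U where U: "inj_on U (Field \<tau>)" "U ` Field \<tau> \<subseteq> ?N - ?B"
      using card_of_ordLeq[of "Field \<tau>" "?N - ?B"] by blast
    have "complete_ultrafilter \<kappa> (U \<alpha>) \<and> (\<exists>f \<in> Field \<kappa> \<rightarrow> Field \<kappa>.
        ultrapower_ordinal \<kappa> (U \<alpha>) f =o \<kappa> \<and> fibre_bounded \<kappa> (cardSuc (\<theta> \<alpha>)) f)"
      if \<alpha>: "\<alpha> \<in> Field \<tau>" for \<alpha>
    proof -
      have n: "normal_ultrafilter \<kappa> (U \<alpha>)" and "U \<alpha> \<notin> ?B" using U(2) \<alpha> by blast+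
      then have comp: "complete_ultrafilter \<kappa> (U \<alpha>)"
        by (intro normal_ultrafilter_complete[OF n r])
          (auto simp: normal_ultrafilter_def nonprincipal_ultrafilter_on_def)
      have ca: "Card_order (\<theta> \<alpha>)" and ne: "\<theta> \<alpha> \<noteq> {}" using assms(3)[OF \<alpha>] by auto
      \<comment> \<open>A fibre of the identity has at most one point, so sending it to
        \<open>z\<close> shows that its size is at most the nonzero cardinal
        \<open>\<theta> \<alpha>\<close>.\<close>
      obtain z where z: "z \<in> Field (\<theta> \<alpha>)" using ne by (auto simp: Field_def)
      have "|{x \<in> Field \<kappa>. x = \<beta>}| <o cardSuc (\<theta> \<alpha>)" for \<beta>
      proof -
        have "|{x \<in> Field \<kappa>. x = \<beta>}| \<le>o |Field (\<theta> \<alpha>)|"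
          by (rule card_of_ordLeqI[of "\<lambda>_. z"]) (use z in \<open>auto simp: inj_on_def\<close>)
        then have "|{x \<in> Field \<kappa>. x = \<beta>}| \<le>o \<theta> \<alpha>"
          using card_of_Field_ordIso[OF ca] ordLeq_ordIso_trans by blast
        then show ?thesis using cardSuc_ordLeq_ordLess[OF ca card_of_Card_order] by blast
      qed
      then have "fibre_bounded \<kappa> (cardSuc (\<theta> \<alpha>)) (\<lambda>x. x)" by (simp add: fibre_bounded_def)
      then show ?thesis using comp normal_ultrapower_ordinal_id[OF n comp r] by blast
    qed
    then show "\<exists>U. inj_on U (Field \<tau>) \<and> (\<forall>\<alpha> \<in> Field \<tau>. complete_ultrafilter \<kappa> (U \<alpha>) \<and>
        (\<exists>f \<in> Field \<kappa> \<rightarrow> Field \<kappa>. ultrapower_ordinal \<kappa> (U \<alpha>) f =o \<kappa> \<and>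
           fibre_bounded \<kappa> (cardSuc (\<theta> \<alpha>)) f))"
      using U(1) by blast
  next
    assume "\<exists>U. inj_on U (Field \<tau>) \<and> (\<forall>\<alpha> \<in> Field \<tau>. complete_ultrafilter \<kappa> (U \<alpha>) \<and>
        (\<exists>f \<in> Field \<kappa> \<rightarrow> Field \<kappa>. ultrapower_ordinal \<kappa> (U \<alpha>) f =o \<kappa> \<and>
           fibre_bounded \<kappa> (cardSuc (\<theta> \<alpha>)) f))"
    then obtain U where inj: "inj_on U (Field \<tau>)"
      and U: "\<And>\<alpha>. \<alpha> \<in> Field \<tau> \<Longrightarrow> complete_ultrafilter \<kappa> (U \<alpha>)"
      and ex: "\<And>\<alpha>. \<alpha> \<in> Field \<tau> \<Longrightarrow> \<exists>f \<in> Field \<kappa> \<rightarrow> Field \<kappa>.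
        ultrapower_ordinal \<kappa> (U \<alpha>) f =o \<kappa> \<and> fibre_bounded \<kappa> (cardSuc (\<theta> \<alpha>)) f"
      by blast
    \<comment> \<open>\<open>?R\<close> decodes an ultrafilter from a normal ultrafilter and a
      graph, in the form given by \<open>ultrafilter_from_image\<close>.\<close>
    let ?R = "\<lambda>(V, G). {X. X \<subseteq> Field \<kappa> \<and> G `` X \<in> V}"
    let ?Q = "?N \<times> Pow (Field \<kappa> \<times> Field \<kappa>)"
    have "U \<alpha> \<in> ?R ` ?Q" if \<alpha>: "\<alpha> \<in> Field \<tau>" for \<alpha>
    proof -
      obtain f where f: "f \<in> Field \<kappa> \<rightarrow> Field \<kappa>" "ultrapower_ordinal \<kappa> (U \<alpha>) f =o \<kappa>"
        "fibre_bounded \<kappa> (cardSuc (\<theta> \<alpha>)) f" using ex[OF \<alpha>] by blast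
      note u = complete_ultrafilterD(2)[OF U[OF \<alpha>]]
      obtain A where A: "A \<in> U \<alpha>" "inj_on f A"
        using fibre_bounded_inj_on_large_set[OF U[OF \<alpha>] f(1) _ _ f(3)] assms(3)[OF \<alpha>] by blast
      let ?G = "{(x, f x) | x. x \<in> A}"
      have "U \<alpha> = ?R (image_ultrafilter \<kappa> f (U \<alpha>), ?G)"
        using ultrafilter_from_image[OF u f(1) A] by simp
      moreover have "image_ultrafilter \<kappa> f (U \<alpha>) \<in> ?N"
        using normal_image_ultrafilter[OF U[OF \<alpha>] r f(1,2)] by simp
      moreover have "?G \<subseteq> Field \<kappa> \<times> Field \<kappa>"
        using ultrafilter_onD(1)[OF u A(1)] f(1) by auto
      ultimately show ?thesis by blast
    qed
    then have "|U ` Field \<tau>| \<le>o |?Q|" by (intro surj_imp_ordLeq[of _ ?R]) blast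
    moreover have "\<tau> =o |U ` Field \<tau>|"
      using card_of_Field_ordIso[OF ct] card_of_ordIsoI[OF inj_on_imp_bij_betw[OF inj]]
        ordIso_symmetric ordIso_transitive by blast
    ultimately have tQ: "\<tau> \<le>o |?Q|" using ordIso_ordLeq_trans by blast
    show "\<tau> \<le>o |?N|"
    proof (rule ccontr)
      assume "\<not> \<tau> \<le>o |?N|"
      \<comment> \<open>As \<tau> is the successor of \<open>?C\<close>, fewer than \<tau> normal
        ultrafilters means at most \<open>?C\<close>. With only \<open>?C\<close> graphs,
        \<open>?Q\<close> would then be too small for \<tau> distinct codes.\<close>
      then have "|?N| <o \<tau>" using not_ordLeq_iff_ordLess[OF card_of_Well_order wt] by blast
      then have "|?N| \<le>o ?C"
        using assms(2) cardSuc_ordLeq_ordLess[OF cC card_of_Card_order] by blast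
      moreover have "|Field \<kappa> \<times> Field \<kappa>| =o |Field \<kappa>|" by (rule card_of_Times_same_infinite[OF inf])
      then obtain p where "bij_betw p (Field \<kappa> \<times> Field \<kappa>) (Field \<kappa>)"
        unfolding card_of_ordIso[symmetric] by blast
      then have "|Pow (Field \<kappa> \<times> Field \<kappa>)| =o |Pow (Field \<kappa>)|"
        by (intro card_of_ordIsoI[OF bij_betw_Pow])
      then have "|Pow (Field \<kappa> \<times> Field \<kappa>)| =o ?C" using pow by (rule ordIso_transitive)
      ultimately have "|?Q| \<le>o ?C"
        using card_of_Times_ordLeq_infinite_Field[OF infC _ _ cC] ordIso_imp_ordLeq by blast
      then show False using tQ Ct ordLeq_transitive not_ordLess_ordLeq by blast
    qed
  qed
qed

end
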